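(* Let $R>0$. There are no hyperbolic cyclic solutions for the $n$-body problem in $\mathbb{H}^2_R$. That is: for every $n\ge 2$ and all masses $m_1,\dots,m_n>0$, there is no solution $w(t)=(w_1(t),\dots,w_n(t))$ of the equations of motion of the $n$-body problem in $\mathbb{H}^2_R$ with hyperbolic cotangent potential (given in the context) that satisfies $$\dot w_k=1+w_k^2-\frac{(w_k-\bar w_k)^2}{2},\qquad k=1,\dots,n.$$
   Context: $\mathbb{H}^2_R=\{w\in\mathbb{C}: \operatorname{Im} w>0\}$ is the upper half plane with the metric $-ds^2=\frac{4R^2}{(w-\bar w)^2}\,dw\,d\bar w$. The $n$-body problem in $\mathbb{H}^2_R$ with hyperbolic cotangent potential, for masses $m_1,\dots,m_n>0$ and positions $w_1(t),\dots,w_n(t)\in\mathbb{H}^2_R$, is the system, for $k=1,\dots,n$, $$\ddot w_k-\frac{2\dot w_k^2}{w_k-\bar w_k}=-\frac{2(w_k-\bar w_k)^3}{R}\sum_{\substack{j=1\\ j\neq k}}^n\frac{m_j(\bar w_j-w_j)^2(w_k-w_j)(\bar w_j-w_k)}{[\Theta_{(k,j)}(w,\bar w)]^{3/2}},$$ where $$\Theta_{(k,j)}(w,\bar w)=[(\bar w_k+w_k)(\bar w_j+w_j)-2(|w_k|^2+|w_j|^2)]^2-(\bar w_k-w_k)^2(\bar w_j-w_j)^2,$$ whose zero set is the singular (collision) set; a solution is defined on an open time interval and stays off the singular set, i.e. $w_k(t)\ne w_j(t)$ for $k\neq j$. A hyperbolic cyclic solution is a solution of this system that moves along (is invariant under)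 the flow of the vector field $\dot w=1+w^2-\frac{(w-\bar w)^2}{2}$, i.e. each component $w_k(t)$ satisfies this differential equation. In real coordinates $w=u+iv$ the vector field is $\dot u=1+u^2+v^2$, $\dot v=2uv$. *)

theory Defs
  imports "HOL-Analysis.Analysis"
begin

definition upper_half_plane :: "complex set" where
  "upper_half_plane = {w. Im w > 0}"

text \<open>The value of \<open>Theta\<close> is always a nonnegative real number (lemma \<open>Theta_eq\<close>), so that the
  principal branch of the complex power in \<open>cotangent_force\<close> is the ordinary real power.\<close>

definition Theta :: "complex \<Rightarrow> complex \<Rightarrow> complex" where
  "Theta wk wj =
     ((cnj wk + wk) * (cnj wj + wj)
        - 2 * (of_real ((cmod wk)\<^sup>2) + of_real ((cmod wj)\<^sup>2)))\<^sup>2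
     - (cnj wk - wk)\<^sup>2 * (cnj wj - wj)\<^sup>2"

definition cotangent_force ::
  "real \<Rightarrow> nat \<Rightarrow> (nat \<Rightarrow> real) \<Rightarrow> (nat \<Rightarrow> complex) \<Rightarrow> nat \<Rightarrow> complex" where
  "cotangent_force R n m w k =
     - (2 * (w k - cnj (w k)) ^ 3 / of_real R) *
       (\<Sum>j\<in>{1..n} - {k}.
          of_real (m j) * (cnj (w j) - w j)\<^sup>2 * (w k - w j) * (cnj (w j) - w k)
          / (Theta (w k) (w j)) powr (3/2))"

text \<open>The configuration at time \<open>t\<close> is \<open>\<lambda>k. w k t\<close>, where only the indices in \<open>{1..n}\<close> matter.\<close>

definition n_body_solution ::
  "real \<Rightarrow> nat \<Rightarrow> (nat \<Rightarrow> real) \<Rightarrow> real set \<Rightarrow> (nat \<Rightarrow> real \<Rightarrow> complex) \<Rightarrow> bool" where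
  "n_body_solution R n m I w \<longleftrightarrow>
     open I \<and> is_interval I \<and> I \<noteq> {} \<and>
     (\<forall>t\<in>I. \<forall>k\<in>{1..n}. w k t \<in> upper_half_plane) \<and>
     (\<forall>t\<in>I. \<forall>k\<in>{1..n}. \<forall>j\<in>{1..n}. k \<noteq> j \<longrightarrow> w k t \<noteq> w j t) \<and>
     (\<exists>w' w''. \<forall>t\<in>I. \<forall>k\<in>{1..n}.
        (w k has_vector_derivative w' k t) (at t) \<and>
        (w' k has_vector_derivative w'' k t) (at t) \<and>
        w'' k t - 2 * (w' k t)\<^sup>2 / (w k t - cnj (w k t))
          = cotangent_force R n m (\<lambda>i. w i t) k)"

definition hyperbolic_cyclic_field :: "complex \<Rightarrow> complex" where
  "hyperbolic_cyclic_field w = 1 + w\<^sup>2 - (w - cnj w)\<^sup>2 / 2"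

definition hyperbolic_cyclic_solution ::
  "real \<Rightarrow> nat \<Rightarrow> (nat \<Rightarrow> real) \<Rightarrow> real set \<Rightarrow> (nat \<Rightarrow> real \<Rightarrow> complex) \<Rightarrow> bool" where
  "hyperbolic_cyclic_solution R n m I w \<longleftrightarrow>
     n_body_solution R n m I w \<and>
     (\<forall>t\<in>I. \<forall>k\<in>{1..n}.
        (w k has_vector_derivative hyperbolic_cyclic_field (w k t)) (at t))"

lemma hyperbolic_cyclic_field_real_coordinates:
  "hyperbolic_cyclic_field (Complex u v) = Complex (1 + u\<^sup>2 + v\<^sup>2) (2 * u * v)"
  by (simp add: hyperbolic_cyclic_field_def complex_eq_iff power2_eq_square)

lemma Theta_eq:
  "Theta wk wj =
     of_real (4 * ((Re wk - Re wj)\<^sup>2 + (Im wk - Im wj)\<^sup>2)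
                * ((Re wk - Re wj)\<^sup>2 + (Im wk + Im wj)\<^sup>2))"
  unfolding Theta_def cmod_power2
  by (simp add: complex_eq_iff power2_eq_square algebra_simps)

lemma Theta_eq_0_iff:
  assumes "wk \<in> upper_half_plane" "wj \<in> upper_half_plane"
  shows "Theta wk wj = 0 \<longleftrightarrow> wk = wj"
proof -
  let ?A = "(Re wk - Re wj)\<^sup>2 + (Im wk - Im wj)\<^sup>2"
  let ?B = "(Re wk - Re wj)\<^sup>2 + (Im wk + Im wj)\<^sup>2"
  have "Im wk + Im wj > 0"
    using assms by (simp add: upper_half_plane_def)
  then have B: "?B \<noteq> 0"
    by (simp only: sum_power2_eq_zero_iff) simp
  have "Theta wk wj = 0 \<longleftrightarrow> 4 * ?A * ?B = 0"
    unfolding Theta_eq by (rule of_real_eq_0_iff)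
  also have "\<dots> \<longleftrightarrow> ?A = 0"
    using B by (simp only: mult_eq_0_iff) simp
  also have "\<dots> \<longleftrightarrow> wk = wj"
    by (simp only: sum_power2_eq_zero_iff complex_eq_iff) simp
  finally show ?thesis .
qed

lemma Theta_powr_eq:
  "Theta wk wj powr (3/2) = of_real (Re (Theta wk wj) powr (3/2))"
proof -
  obtain x where x: "Theta wk wj = of_real x" "x \<ge> 0"
    using Theta_eq by (metis mult_nonneg_nonneg sum_power2_ge_zero zero_le_numeral)
  have "complex_of_real (x powr (3/2)) = of_real x powr of_real (3/2)"
    using x(2) by (intro powr_of_real [symmetric]) auto
  then show ?thesis using x(1) by simp
qed

end

theory Submission imports Defs begin

text \<open>The pairwise forces are covariant under the isometries of the half plane, so the Killing field
  \<open>1 + w\<^sup>2\<close> yields a momentum balance: weighting the equations by \<open>m k / (Im w)\<^sup>2\<close> and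
  pairing with \<open>1 + w\<^sup>2\<close>, the forces cancel in pairs. Along the (non-Killing) cyclic flow the
  accelerations contribute a multiple of \<open>\<Sum>k. m k * u k * (3 * (1 + (u k)\<^sup>2) + (v k)\<^sup>2)\<close>, where
  \<open>w k = u k + \<i> * v k\<close>, so this sum vanishes at all times. But \<open>u' = 1 + u\<^sup>2 + v\<^sup>2\<close> and
  \<open>v' = 2 u v\<close> make it strictly increasing.\<close>

definition pair_force ::
  "real \<Rightarrow> (nat \<Rightarrow> real) \<Rightarrow> (nat \<Rightarrow> complex) \<Rightarrow> nat \<Rightarrow> nat \<Rightarrow> complex" where
  "pair_force R m w k j =
     - (2 * (w k - cnj (w k)) ^ 3 / of_real R) *
       (of_real (m j) * (cnj (w j) - w j)\<^sup>2 * (w k - w j) * (cnj (w j) - w k)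
        / (Theta (w k) (w j)) powr (3/2))"

text \<open>Up to the constant factor \<open>R\<^sup>2\<close>, this is the hyperbolic inner product
  at \<open>z\<close> of \<open>a\<close> with \<open>1 + z\<^sup>2\<close>, the Killing field
  generating the rotations about \<open>\<i>\<close>.\<close>

definition killing_component :: "complex \<Rightarrow> complex \<Rightarrow> real" where
  "killing_component z a = Re (cnj (1 + z\<^sup>2) * a) / (Im z)\<^sup>2"

lemma killing_component_sum:
  "killing_component z (sum f A) = (\<Sum>j\<in>A. killing_component z (f j))"
  by (simp add: killing_component_def sum_distrib_left sum_divide_distrib)

lemma cotangent_force_eq_sum_pair_force:
  "cotangent_force R n m w k = (\<Sum>j\<in>{1..n} - {k}. pair_force R m w k j)"
  by (simp add: cotangent_force_def pair_force_def sum_distrib_left)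

lemma Re_mult_of_real_left: "Re (a * (of_real c * b)) = c * Re (a * b)"
  by (simp add: algebra_simps)

text \<open>The right-hand side separates a factor symmetric in \<open>k\<close> and
  \<open>j\<close> from a bracket that changes sign under their exchange; this prepares the pairwise
  cancellation.\<close>

lemma killing_component_pair_force:
  assumes "Im (w k) \<noteq> 0"
  shows "m k * killing_component (w k) (pair_force R m w k j) =
    128 * m k * m j * (Im (w k))\<^sup>2 * (Im (w j))\<^sup>2 / (R * Re (Theta (w k) (w j)) powr (3/2)) *
    (Re (w j) - Re (w k) + Re (w k) * (cmod (w j))\<^sup>2 - Re (w j) * (cmod (w k))\<^sup>2)"
proof -
  obtain u v where z: "w k = Complex u v" by (metis complex.exhaust)
  obtain x y where z': "w j = Complex x y" by (metis complex.exhaust)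
  define T where "T = Re (Theta (w k) (w j)) powr (3/2)"
  have v: "v \<noteq> 0" using assms z by simp
  \<comment> \<open>All real factors, including the power of \<open>Theta\<close>, are collected in
    front, so that they can be pulled out of \<open>Re\<close>.\<close>
  have "pair_force R m w k j = of_real (64 * m j * v ^ 3 * y\<^sup>2 / (R * T)) *
      (\<i> * (w k - w j) * (w k - cnj (w j)))"
  proof -
    have "w k - cnj (w k) = 2 * \<i> * of_real v" "cnj (w j) - w j = - 2 * \<i> * of_real y"
      by (simp_all add: z z' complex_eq_iff)
    then show ?thesis
      unfolding pair_force_def Theta_powr_eq T_def [symmetric]
      by (simp add: power_mult_distrib power3_eq_cube power2_eq_square divide_simps)
         (simp add: algebra_simps)
  qed
  then have "killing_component (w k) (pair_force R m w k j) =
      (64 * m j * v ^ 3 * y\<^sup>2 / (R * T)) *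
      Re (cnj (1 + (w k)\<^sup>2) * (\<i> * (w k - w j) * (w k - cnj (w j)))) / v\<^sup>2"
    by (simp only: killing_component_def Re_mult_of_real_left z complex.sel)
  \<comment> \<open>The factor \<open>2 * v\<close> gained here turns \<open>v ^ 3\<close> into
    \<open>v ^ 4\<close>; division by the metric factor \<open>v\<^sup>2\<close> leaves
    \<open>v\<^sup>2 * y\<^sup>2\<close>, symmetric in the two bodies.\<close>
  also have "Re (cnj (1 + (w k)\<^sup>2) * (\<i> * (w k - w j) * (w k - cnj (w j)))) =
      2 * v * (x - u + u * (x\<^sup>2 + y\<^sup>2) - x * (u\<^sup>2 + v\<^sup>2))"
    by (simp add: z z' power2_eq_square algebra_simps)
  finally have "killing_component (w k) (pair_force R m w k j) =
      64 * m j * v ^ 3 * y\<^sup>2 / (R * T) *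
      (2 * v * (x - u + u * (x\<^sup>2 + y\<^sup>2) - x * (u\<^sup>2 + v\<^sup>2))) / v\<^sup>2" .
  moreover have "(cmod (w k))\<^sup>2 = u\<^sup>2 + v\<^sup>2" "(cmod (w j))\<^sup>2 = x\<^sup>2 + y\<^sup>2"
    by (simp_all add: z z' cmod_power2)
  ultimately show ?thesis
    unfolding T_def [symmetric] using v
    by (simp add: z z' power2_eq_square power3_eq_cube)
qed

lemma Theta_commute: "Theta z z' = Theta z' z"
  by (simp add: Theta_def algebra_simps)

lemma killing_component_cotangent_force_sum:
  assumes "\<And>k. k \<in> {1..n} \<Longrightarrow> Im (w k) \<noteq> 0"
  shows "(\<Sum>k\<in>{1..n}. m k * killing_component (w k) (cotangent_force R n m w k)) = 0"
proof -
  define g where "g k j = m k * killing_component (w k) (pair_force R m w k j)" for k j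
  have anti: "g k j = - g j k" if "k \<in> {1..n}" "j \<in> {1..n}" for k j
  proof -
    define c where "c = 128 * m k * m j * (Im (w k))\<^sup>2 * (Im (w j))\<^sup>2 /
        (R * Re (Theta (w k) (w j)) powr (3/2))"
    have "g k j = c * (Re (w j) - Re (w k) + Re (w k) * (cmod (w j))\<^sup>2 - Re (w j) * (cmod (w k))\<^sup>2)"
      unfolding g_def c_def by (rule killing_component_pair_force [where w = w, OF assms [OF that(1)]])
    moreover have "g j k =
        c * (Re (w k) - Re (w j) + Re (w j) * (cmod (w k))\<^sup>2 - Re (w k) * (cmod (w j))\<^sup>2)"
      unfolding g_def c_def killing_component_pair_force [where w = w, OF assms [OF that(2)]]
      by (simp only: Theta_commute [of "w j"] mult_ac)
    ultimately show ?thesis by (simp add: algebra_simps)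
  qed
  have "(\<Sum>k\<in>{1..n}. m k * killing_component (w k) (cotangent_force R n m w k)) =
      (\<Sum>k\<in>{1..n}. \<Sum>j\<in>{1..n} - {k}. g k j)"
    by (simp add: cotangent_force_eq_sum_pair_force killing_component_sum g_def sum_distrib_left)
  also have "\<dots> = (\<Sum>k\<in>{1..n}. \<Sum>j\<in>{1..n}. g k j)"
  proof (rule sum.cong [OF refl])
    fix k assume k: "k \<in> {1..n}"
    \<comment> \<open>Antisymmetry on the diagonal kills the excluded term, so both indices may run
      over the full square.\<close>
    have "g k k = 0" using anti [OF k k] by simp
    then show "(\<Sum>j\<in>{1..n} - {k}. g k j) = (\<Sum>j\<in>{1..n}. g k j)"
      by (simp only: sum_diff1 finite_atLeastAtMost) simp
  qed
  finally have eq: "(\<Sum>k\<in>{1..n}. m k * killing_component (w k) (cotangent_force R n m w k)) =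
      (\<Sum>k\<in>{1..n}. \<Sum>j\<in>{1..n}. g k j)" .
  \<comment> \<open>Exchanging the order of summation shows that the double sum equals its own
    negative.\<close>
  have "(\<Sum>k\<in>{1..n}. \<Sum>j\<in>{1..n}. g k j) = (\<Sum>k\<in>{1..n}. \<Sum>j\<in>{1..n}. - g j k)"
    by (intro sum.cong refl anti)
  also have "\<dots> = - (\<Sum>j\<in>{1..n}. \<Sum>k\<in>{1..n}. g j k)"
    by (subst sum.swap) (simp add: sum_negf)
  finally show ?thesis using eq by linarith
qed

text \<open>Supplies the second derivative along the flow. The conjugate of \<open>d\<close> enters
  because the field is not holomorphic.\<close>

lemma hyperbolic_cyclic_field_has_vector_derivative:
  assumes "(z has_vector_derivative d) (at t)"
  shows "((\<lambda>s. hyperbolic_cyclic_field (z s)) has_vector_derivative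
    (2 * z t * d - (z t - cnj (z t)) * (d - cnj d))) (at t)"
  unfolding hyperbolic_cyclic_field_def power2_eq_square
  by (rule derivative_eq_intros assms has_vector_derivative_cnj | simp)+

text \<open>The vector being paired is the covariant acceleration of a flow line, that is, the left
  side of the equations of motion with both derivatives expressed through the field.\<close>

lemma killing_component_cyclic_acceleration:
  assumes "Im z \<noteq> 0" and d: "d = hyperbolic_cyclic_field z"
  shows "killing_component z
      (2 * z * d - (z - cnj z) * (d - cnj d) - 2 * d\<^sup>2 / (z - cnj z)) =
    4 * Re z * (3 * (1 + (Re z)\<^sup>2) + (Im z)\<^sup>2)"
proof -
  obtain u v where z: "z = Complex u v" by (metis complex.exhaust)
  have v: "v \<noteq> 0" using assms z by simp
  define a where "a = 1 + u\<^sup>2 + v\<^sup>2"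
  have d': "d = Complex a (2 * u * v)"
    by (simp add: d z a_def hyperbolic_cyclic_field_real_coordinates)
  have "2 * d\<^sup>2 / (z - cnj z) = Complex (4 * u * a) ((4 * u\<^sup>2 * v\<^sup>2 - a\<^sup>2) / v)"
  proof -
    have "z - cnj z = 2 * \<i> * of_real v" by (simp add: z complex_eq_iff)
    moreover have "2 * d\<^sup>2 =
        Complex (4 * u * a) ((4 * u\<^sup>2 * v\<^sup>2 - a\<^sup>2) / v) * (2 * \<i> * of_real v)"
      using v by (simp add: d' complex_eq_iff power2_eq_square)
    ultimately show ?thesis using v by (simp add: nonzero_divide_eq_eq)
  qed
  moreover have "2 * z * d - (z - cnj z) * (d - cnj d) =
      Complex (2 * u * a + 4 * u * v\<^sup>2) (2 * v * a + 4 * u\<^sup>2 * v)"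
    by (simp add: d' z complex_eq_iff power2_eq_square algebra_simps)
  ultimately have "2 * z * d - (z - cnj z) * (d - cnj d) - 2 * d\<^sup>2 / (z - cnj z) =
      Complex (4 * u * v\<^sup>2 - 2 * u * a) (2 * v * a + a\<^sup>2 / v)"
    using v by (simp add: complex_eq_iff field_simps power2_eq_square)
  moreover have "cnj (1 + z\<^sup>2) = Complex (1 + u\<^sup>2 - v\<^sup>2) (- 2 * u * v)"
    by (simp add: z complex_eq_iff power2_eq_square)
  ultimately have "killing_component z
      (2 * z * d - (z - cnj z) * (d - cnj d) - 2 * d\<^sup>2 / (z - cnj z)) =
      ((1 + u\<^sup>2 - v\<^sup>2) * (4 * u * v\<^sup>2 - 2 * u * a) + 2 * u * v * (2 * v * a + a\<^sup>2 / v)) / v\<^sup>2"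
    by (simp add: killing_component_def z)
  also have "2 * u * v * (2 * v * a + a\<^sup>2 / v) = 4 * u * v\<^sup>2 * a + 2 * u * a\<^sup>2"
    using v by (simp add: field_simps power2_eq_square)
  \<comment> \<open>The terms \<open>2 * u * a\<^sup>2\<close> cancel after writing
    \<open>1 + u\<^sup>2 - v\<^sup>2\<close> as \<open>a - 2 * v\<^sup>2\<close>; what remains is
    divisible by \<open>v\<^sup>2\<close>, which removes the metric denominator.\<close>
  also have "(1 + u\<^sup>2 - v\<^sup>2) * (4 * u * v\<^sup>2 - 2 * u * a) + (4 * u * v\<^sup>2 * a + 2 * u * a\<^sup>2) =
      (4 * u * (3 * (1 + u\<^sup>2) + v\<^sup>2)) * v\<^sup>2"
    by (simp add: a_def algebra_simps power2_eq_square)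
  finally show ?thesis using v by (simp add: z)
qed

text \<open>The derivative is grouped as a product of positive factors plus a nonnegative term, so
  that its sign can be read off.\<close>

lemma momentum_density_has_real_derivative:
  fixes u v :: "real \<Rightarrow> real"
  assumes "(u has_real_derivative 1 + (u t)\<^sup>2 + (v t)\<^sup>2) (at t)"
    and "(v has_real_derivative 2 * u t * v t) (at t)"
  shows "((\<lambda>s. u s * (3 * (1 + (u s)\<^sup>2) + (v s)\<^sup>2)) has_real_derivative
    (1 + (u t)\<^sup>2 + (v t)\<^sup>2) * (3 + 9 * (u t)\<^sup>2 + (v t)\<^sup>2) + 4 * (u t)\<^sup>2 * (v t)\<^sup>2) (at t)"
  by (rule derivative_eq_intros assms refl)+ (simp add: power2_eq_square algebra_simps)

theorem theorem3:
  fixes R :: real and n :: nat and m :: "nat \<Rightarrow> real"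
  assumes "R > 0" and "n \<ge> 2" and "\<And>k. k \<in> {1..n} \<Longrightarrow> m k > 0"
  shows "\<not> (\<exists>I w. hyperbolic_cyclic_solution R n m I w)"
proof
  assume "\<exists>I w. hyperbolic_cyclic_solution R n m I w"
  then obtain I w where sol: "n_body_solution R n m I w"
    and flow: "\<And>t k. t \<in> I \<Longrightarrow> k \<in> {1..n} \<Longrightarrow>
      (w k has_vector_derivative hyperbolic_cyclic_field (w k t)) (at t)"
    unfolding hyperbolic_cyclic_solution_def by blast
  from sol obtain w' w'' where eqs: "\<forall>t\<in>I. \<forall>k\<in>{1..n}.
      (w k has_vector_derivative w' k t) (at t) \<and> (w' k has_vector_derivative w'' k t) (at t) \<and>
      w'' k t - 2 * (w' k t)\<^sup>2 / (w k t - cnj (w k t)) = cotangent_force R n m (\<lambda>i. w i t) k"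
    unfolding n_body_solution_def by blast
  then have d1: "(w k has_vector_derivative w' k t) (at t)"
    and d2: "(w' k has_vector_derivative w'' k t) (at t)"
    and eom: "w'' k t - 2 * (w' k t)\<^sup>2 / (w k t - cnj (w k t)) =
      cotangent_force R n m (\<lambda>i. w i t) k"
    if "t \<in> I" "k \<in> {1..n}" for t k
    using that by blast+
  from sol have I: "open I" "I \<noteq> {}"
    and up: "\<And>t k. t \<in> I \<Longrightarrow> k \<in> {1..n} \<Longrightarrow> Im (w k t) > 0"
    unfolding n_body_solution_def upper_half_plane_def by blast+
  have w': "w' k t = hyperbolic_cyclic_field (w k t)" if "t \<in> I" "k \<in> {1..n}" for k t
    using d1 [OF that] flow [OF that] by (rule vector_derivative_unique_at)
  have w'': "w'' k t = 2 * w k t * w' k t - (w k t - cnj (w k t)) * (w' k t - cnj (w' k t))"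
    if "t \<in> I" "k \<in> {1..n}" for k t
  proof (rule vector_derivative_unique_at [OF d2 [OF that]])
    show "(w' k has_vector_derivative
        2 * w k t * w' k t - (w k t - cnj (w k t)) * (w' k t - cnj (w' k t))) (at t)"
      \<comment> \<open>The identity between \<open>w'\<close> and the field holds only on
        \<open>I\<close>; openness of \<open>I\<close> makes it hold near \<open>t\<close>, which is
        enough to transfer the derivative.\<close>
      by (rule has_vector_derivative_transform_within_open
          [OF hyperbolic_cyclic_field_has_vector_derivative [OF d1 [OF that]] I(1) that(1)])
         (rule w' [OF _ that(2), symmetric])
  qed
  \<comment> \<open>One quarter of the total Killing component of the accelerations, which the
    equations of motion equate with that of the forces.\<close>
  define P where "P t = (\<Sum>k\<in>{1..n}. m k * (Re (w k t) * (3 * (1 + (Re (w k t))\<^sup>2) + (Im (w k t))\<^sup>2)))"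
    for t
  have P0: "P t = 0" if t: "t \<in> I" for t
  proof -
    have "4 * P t =
        (\<Sum>k\<in>{1..n}. m k * killing_component (w k t) (cotangent_force R n m (\<lambda>i. w i t) k))"
      unfolding P_def sum_distrib_left
    proof (rule sum.cong [OF refl])
      fix k assume k: "k \<in> {1..n}"
      have "Im (w k t) \<noteq> 0" using up [OF t k] by simp
      from killing_component_cyclic_acceleration [OF this w' [OF t k]]
      show "4 * (m k * (Re (w k t) * (3 * (1 + (Re (w k t))\<^sup>2) + (Im (w k t))\<^sup>2))) =
        m k * killing_component (w k t) (cotangent_force R n m (\<lambda>i. w i t) k)"
        by (simp add: eom [OF t k, symmetric] w'' [OF t k])
    qed
    also have "\<dots> = 0"
      using up [OF t] by (intro killing_component_cotangent_force_sum) force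
    finally show ?thesis by simp
  qed
  from I obtain t where t: "t \<in> I" by blast
  define D where "D k = (1 + (Re (w k t))\<^sup>2 + (Im (w k t))\<^sup>2) *
      (3 + 9 * (Re (w k t))\<^sup>2 + (Im (w k t))\<^sup>2) + 4 * (Re (w k t))\<^sup>2 * (Im (w k t))\<^sup>2" for k
  have "((\<lambda>s. Re (w k s) * (3 * (1 + (Re (w k s))\<^sup>2) + (Im (w k s))\<^sup>2))
      has_real_derivative D k) (at t)" if k: "k \<in> {1..n}" for k
  proof -
    have "hyperbolic_cyclic_field (w k t) =
        Complex (1 + (Re (w k t))\<^sup>2 + (Im (w k t))\<^sup>2) (2 * Re (w k t) * Im (w k t))"
      using hyperbolic_cyclic_field_real_coordinates [of "Re (w k t)" "Im (w k t)"] by simp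
    with flow [OF t k] have
      "((\<lambda>s. Re (w k s)) has_real_derivative 1 + (Re (w k t))\<^sup>2 + (Im (w k t))\<^sup>2) (at t)"
      "((\<lambda>s. Im (w k s)) has_real_derivative 2 * Re (w k t) * Im (w k t)) (at t)"
      by (simp_all add: has_vector_derivative_complex_iff)
    from momentum_density_has_real_derivative [OF this] show ?thesis
      by (simp add: D_def)
  qed
  then have "(P has_real_derivative (\<Sum>k\<in>{1..n}. m k * D k)) (at t)"
    unfolding P_def by (intro DERIV_sum DERIV_cmult) auto
  \<comment> \<open>\<open>P\<close> vanishes on the open set \<open>I\<close>, hence in a
    neighbourhood of \<open>t\<close>.\<close>
  moreover have "(P has_real_derivative 0) (at t)"
    by (rule has_field_derivative_transform_within_open [OF DERIV_const [of 0] I(1) t])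
       (simp add: P0)
  ultimately have "(\<Sum>k\<in>{1..n}. m k * D k) = 0"
    by (rule DERIV_unique)
  moreover have "D k > 0" for k
    unfolding D_def by (intro add_pos_nonneg mult_pos_pos) auto
  \<comment> \<open>The masses are positive, and \<open>n \<ge> 2\<close> makes the index set
    nonempty, so the sum is strictly positive.\<close>
  then have "(\<Sum>k\<in>{1..n}. m k * D k) > 0"
    using assms by (intro sum_pos) auto
  ultimately show False by simp
qed

end
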